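(* Let $\mathbb{S} = \{0,1\}$ be the Sierpi\'nski space, i.e., the poset with $0<1$ whose open subsets are its downsets, and let $\mathcal{O}(\mathbb{S})$ be its complete Heyting algebra of open subsets (a three-element chain). The category $\mathsf{CHA}$ of complete Heyting algebras and their morphisms does not have a coproduct of $\mathcal{O}(\mathbb{S})$ with itself.
   Context: A Heyting algebra is a bounded lattice $A$ with a binary operation $\to$ such that $a \wedge x \le b \iff x \le a \to b$ for all $a,b,x \in A$. A complete Heyting algebra is a Heyting algebra that is complete as a lattice. A morphism of complete Heyting algebras is a map $\varphi\colon A \to B$ that is a homomorphism of complete lattices (preserves arbitrary joins and arbitrary meets) such that $\varphi(a_1 \to a_2) = \varphi(a_1) \to \varphi(a_2)$ for all $a_1,a_2 \in A$. For a topological space $X$, $\mathcal{O}(X)$ denotes the complete Heyting algebra of open subsets of $X$ ordered by inclusion. For a poset, a downset is a subset $S$ such that $p \le s$ and $s \in S$ imply $p \in S$. *)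

theory Defs
  imports "HOL-Algebra.Complete_Lattice" "HOL-Analysis.Abstract_Topology"
begin

section \<open>Complete Heyting algebras\<close>

record 'a heyting = "'a gorder" +
  himp :: "'a \<Rightarrow> 'a \<Rightarrow> 'a" (infixr \<open>\<rightharpoonup>\<index>\<close> 60)

locale heyting_algebra = bounded_lattice A for A :: "('a, 'm) heyting_scheme" (structure) +
  assumes himp_closed [simp, intro]:
      "\<lbrakk>a \<in> carrier A; b \<in> carrier A\<rbrakk> \<Longrightarrow> a \<rightharpoonup> b \<in> carrier A"
    and himp_residuated:
      "\<lbrakk>a \<in> carrier A; b \<in> carrier A; x \<in> carrier A\<rbrakk> \<Longrightarrow> a \<sqinter> x \<sqsubseteq> b \<longleftrightarrow> x \<sqsubseteq> a \<rightharpoonup> b"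

locale complete_heyting_algebra = heyting_algebra A + complete_lattice A
  for A :: "('a, 'm) heyting_scheme" (structure)

text \<open>Morphisms are functions that are undefined outside the carrier of their source, so that
  equality of morphisms is equality of functions and composition is \<^const>\<open>compose\<close>.  The
  conditions \<^const>\<open>sup_pres\<close> and \<^const>\<open>inf_pres\<close> include the empty join and the empty meet.\<close>

definition cha_hom ::
    "('a, 'm) heyting_scheme \<Rightarrow> ('b, 'n) heyting_scheme \<Rightarrow> ('a \<Rightarrow> 'b) set" where
  "cha_hom A B =
     {\<phi> \<in> carrier A \<rightarrow>\<^sub>E carrier B.
        sup_pres A B \<phi> \<and> inf_pres A B \<phi> \<and>
        (\<forall>a\<^sub>1 \<in> carrier A. \<forall>a\<^sub>2 \<in> carrier A. \<phi> (a\<^sub>1 \<rightharpoonup>\<^bsub>A\<^esub> a\<^sub>2) = \<phi> a\<^sub>1 \<rightharpoonup>\<^bsub>B\<^esub> \<phi> a\<^sub>2)}"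


section \<open>Binary coproducts\<close>

text \<open>A single formula cannot quantify over complete Heyting algebras on all types, so the type
  that carries the test objects \<open>B\<close> of the universal property is a parameter.  A coproduct in
  the category of all complete Heyting algebras satisfies this predicate for every choice of
  \<open>'t\<close>; hence refuting the predicate for one \<open>'t\<close> shows that \<open>(C, \<iota>\<^sub>1, \<iota>\<^sub>2)\<close> is not a coproduct.\<close>

definition is_cha_coproduct ::
    "'t itself \<Rightarrow> 'a heyting \<Rightarrow> 'b heyting \<Rightarrow> 'c heyting \<Rightarrow> ('a \<Rightarrow> 'c) \<Rightarrow> ('b \<Rightarrow> 'c) \<Rightarrow> bool" where
  "is_cha_coproduct TYPE('t) A\<^sub>1 A\<^sub>2 C \<iota>\<^sub>1 \<iota>\<^sub>2 \<longleftrightarrow>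
     complete_heyting_algebra C \<and> \<iota>\<^sub>1 \<in> cha_hom A\<^sub>1 C \<and> \<iota>\<^sub>2 \<in> cha_hom A\<^sub>2 C \<and>
     (\<forall>B :: 't heyting. complete_heyting_algebra B \<longrightarrow>
        (\<forall>f \<in> cha_hom A\<^sub>1 B. \<forall>g \<in> cha_hom A\<^sub>2 B.
           \<exists>!h. h \<in> cha_hom C B \<and>
                compose (carrier A\<^sub>1) h \<iota>\<^sub>1 = f \<and> compose (carrier A\<^sub>2) h \<iota>\<^sub>2 = g))"


section \<open>Open sets and the Sierpinski space\<close>

definition opens :: "'a topology \<Rightarrow> 'a set heyting" where
  "opens X =
     \<lparr>carrier = {U. openin X U}, eq = (=), le = (\<subseteq>),
      himp = (\<lambda>U V. \<Union> {W. openin X W \<and> U \<inter> W \<subseteq> V})\<rparr>"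

definition downset_in :: "'a::order set \<Rightarrow> 'a set \<Rightarrow> bool" where
  "downset_in P S \<longleftrightarrow> S \<subseteq> P \<and> (\<forall>p \<in> P. \<forall>s \<in> S. p \<le> s \<longrightarrow> p \<in> S)"

definition sierpinski :: "nat topology" where
  "sierpinski = topology (downset_in {0, 1})"

lemma istopology_downset_in: "istopology (downset_in P)"
  unfolding istopology_def downset_in_def by blast

lemma openin_sierpinski: "openin sierpinski U \<longleftrightarrow> downset_in {0, 1} U"
  by (simp add: sierpinski_def istopology_downset_in topology_inverse')

lemma topspace_sierpinski: "topspace sierpinski = {0, 1}"
  unfolding topspace_def openin_sierpinski by (auto simp: downset_in_def)

lemma carrier_opens_sierpinski: "carrier (opens sierpinski) = {{}, {0}, {0, 1}}"
proof -
  have "downset_in {0, 1} U \<longleftrightarrow> U \<in> {{}, {0}, {0, 1}}" for U :: "nat set"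
    by (cases "0 \<in> U"; cases "1 \<in> U") (auto simp: downset_in_def)
  then show ?thesis by (auto simp: opens_def openin_sierpinski)
qed

lemma complete_heyting_algebra_opens: "complete_heyting_algebra (opens X)"
proof -
  let ?O = "opens X"
  have po: "partial_order ?O"
    by standard (auto simp: opens_def)
  have lub: "least ?O (\<Union>\<U>) (Upper ?O \<U>)" if "\<U> \<subseteq> carrier ?O" for \<U>
    using that by (auto simp: least_def Upper_def opens_def)
  have glb: "greatest ?O (\<Union>{W. openin X W \<and> (\<forall>U\<in>\<U>. W \<subseteq> U)}) (Lower ?O \<U>)"
    if "\<U> \<subseteq> carrier ?O" for \<U>
    using that by (auto simp: greatest_def Lower_def opens_def)
  have cl: "complete_lattice ?O"
    by (rule partial_order.complete_latticeI [OF po]) (blast intro: lub glb)+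
  interpret complete_lattice ?O by (rule cl)
  have meet: "U \<sqinter>\<^bsub>?O\<^esub> V = U \<inter> V" if "openin X U" "openin X V" for U V
  proof -
    have "greatest ?O (U \<inter> V) (Lower ?O {U, V})"
      using that by (auto simp: greatest_def Lower_def opens_def)
    moreover have "greatest ?O (U \<sqinter>\<^bsub>?O\<^esub> V) (Lower ?O {U, V})"
      unfolding meet_def using that by (intro inf_of_two_greatest) (auto simp: opens_def)
    ultimately show ?thesis by (rule greatest_unique [symmetric])
  qed
  have imp: "U \<sqinter>\<^bsub>?O\<^esub> W \<sqsubseteq>\<^bsub>?O\<^esub> V \<longleftrightarrow> W \<sqsubseteq>\<^bsub>?O\<^esub> U \<rightharpoonup>\<^bsub>?O\<^esub> V"
    if "U \<in> carrier ?O" "V \<in> carrier ?O" "W \<in> carrier ?O" for U V W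
    using that meet[of U W] by (auto simp: opens_def)
  have closed: "U \<rightharpoonup>\<^bsub>?O\<^esub> V \<in> carrier ?O" for U V
    by (auto simp: opens_def)
  show ?thesis
    by unfold_locales (use imp closed bottom_exists top_exists in auto)
qed

end

theory Submission
  imports Defs
begin

text \<open>
  A morphism from the three-element chain \<open>\<O>(\<S>)\<close> to \<open>B\<close> amounts to an element \<open>b\<close> of \<open>B\<close>
  with \<open>b \<rightharpoonup> \<bottom> = \<bottom>\<close>, the image of the middle element.  A coproduct \<open>C\<close> of \<open>\<O>(\<S>)\<close> with itself
  therefore maps to every complete Heyting algebra with two chosen dense elements, and the image
  is closed under arbitrary joins and meets and under implication.  This image has at most as many
  elements as \<open>C\<close>, so it suffices to find algebras with two dense elements in which every such
  closed subset containing both is larger than \<open>C\<close>.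

  The algebras are those of the downsets of a poset.  In a set \<open>G\<close> of downsets with the three closure
  properties each point \<open>x\<close> lies in a least member \<open>cl x\<close>, and closure under implication makes
  ``having the same least member'' a bisimulation (\<open>cl_zigzag\<close>): what is found below one of two
  equivalent points is found, up to equivalence, below the other.  If a poset is so rigid
  that any such equivalence respecting two given downsets is the identity, then \<open>cl\<close> is injective and
  \<open>G\<close> has at least as many members as there are points.

  Dense downsets contain all minimal points, so the two generators separate very little: beyond a
  least point they mark only two points, \<open>Rung 0\<close> and \<open>Spur\<close>.  All other points must be told
  apart by what lies below them.  As in the Rieger--Nishimura ladder, any two unmarked
  rungs see different sets of rungs.  The points \<open>Node a m\<close>, with \<open>a\<close>
  in a well-order and \<open>m\<close> a natural number, lie above \<open>Node b n\<close> for \<open>b\<close> before \<open>a\<close> and \<open>n \<ge> m\<close>.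
  The second coordinate is what makes the poset grow past limit stages: for every \<open>a\<close> but the least,
  limit or not, the points \<open>Node a 0\<close>, \<open>Node a 1\<close>, \<open>\<dots>\<close> see strictly decreasing sets of earlier points, so
  a later node sees more than one new point and cannot be bisimilar to any of them.  Rigidity is
  \<open>point_rigid\<close>.  When the well-order is on the subsets of the type of \<open>C\<close>, Cantor's theorem gives
  the contradiction.
\<close>

section \<open>Open continuous maps and morphisms of algebras of open sets\<close>

lemma carrier_opens [simp]: "U \<in> carrier (opens X) \<longleftrightarrow> openin X U"
  by (simp add: opens_def)

lemma complete_lattice_opens: "complete_lattice (opens X)"
  by (rule complete_heyting_algebra.axioms(2) [OF complete_heyting_algebra_opens])

lemma sup_opens:
  assumes "\<U> \<subseteq> carrier (opens X)"
  shows "\<Squnion>\<^bsub>opens X\<^esub> \<U> = \<Union>\<U>"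
proof -
  interpret complete_lattice "opens X" by (rule complete_lattice_opens)
  have "least (opens X) (\<Union>\<U>) (Upper (opens X) \<U>)"
    using assms by (auto simp: least_def Upper_def opens_def)
  then show ?thesis
    by (rule least_unique [OF sup_lub [OF assms]])
qed

lemma inf_opens:
  assumes "\<U> \<subseteq> carrier (opens X)"
  shows "\<Sqinter>\<^bsub>opens X\<^esub> \<U> = X interior_of \<Inter>\<U>"
proof -
  interpret complete_lattice "opens X" by (rule complete_lattice_opens)
  have "greatest (opens X) (X interior_of \<Inter>\<U>) (Lower (opens X) \<U>)"
    unfolding greatest_def Lower_def
  proof (intro conjI ballI)
    show "X interior_of \<Inter>\<U> \<in> {l. \<forall>U. U \<in> \<U> \<inter> carrier (opens X) \<longrightarrow> l \<sqsubseteq>\<^bsub>opens X\<^esub> U} \<inter> carrier (opens X)"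
      using interior_of_subset[of X "\<Inter>\<U>"] by (auto simp: opens_def)
    fix W assume "W \<in> {l. \<forall>U. U \<in> \<U> \<inter> carrier (opens X) \<longrightarrow> l \<sqsubseteq>\<^bsub>opens X\<^esub> U} \<inter> carrier (opens X)"
    then have "openin X W" "W \<subseteq> \<Inter>\<U>"
      using assms by (auto simp: opens_def)
    then show "W \<sqsubseteq>\<^bsub>opens X\<^esub> X interior_of \<Inter>\<U>"
      by (simp add: opens_def interior_of_maximal)
  qed (auto simp: opens_def)
  then show ?thesis
    by (rule greatest_unique [OF inf_glb [OF assms]])
qed

lemma himp_opens: "U \<rightharpoonup>\<^bsub>opens X\<^esub> V = X interior_of (- U \<union> V)"
  by (auto simp: opens_def interior_of_def)

text \<open>Infinite meets and implications of open sets are interiors, so a map whose preimages commute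
  with interiors induces a morphism.  Continuity gives one inclusion and openness the other.\<close>

lemma interior_of_preimage:
  assumes "continuous_map X Y g" "open_map X Y g"
  shows "{x \<in> topspace X. g x \<in> Y interior_of S} = X interior_of {x \<in> topspace X. g x \<in> S}"
    (is "?L = ?R")
proof
  have "openin X ?L"
    using assms(1) by (simp add: continuous_map_def)
  then show "?L \<subseteq> ?R"
    using interior_of_subset[of Y S] by (intro interior_of_maximal) auto
  have "openin Y (g ` ?R)"
    using assms(2) by (simp add: open_map_def)
  moreover have "g ` ?R \<subseteq> S"
    using interior_of_subset [of X "{x \<in> topspace X. g x \<in> S}"] by blast
  ultimately have "g ` ?R \<subseteq> Y interior_of S"
    by (simp add: interior_of_maximal)
  then show "?R \<subseteq> ?L"
    using interior_of_subset_topspace [of X "{x \<in> topspace X. g x \<in> S}"] by blast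
qed

definition preimage_map :: "'a topology \<Rightarrow> 'b topology \<Rightarrow> ('a \<Rightarrow> 'b) \<Rightarrow> 'b set \<Rightarrow> 'a set" where
  "preimage_map X Y g = (\<lambda>V \<in> carrier (opens Y). {x \<in> topspace X. g x \<in> V})"

lemma preimage_map_cha_hom:
  assumes "continuous_map X Y g" "open_map X Y g"
  shows "preimage_map X Y g \<in> cha_hom (opens Y) (opens X)"
proof -
  let ?f = "preimage_map X Y g"
  note pre = interior_of_preimage [OF assms]
  have val: "?f V = {x \<in> topspace X. g x \<in> V}" if "openin Y V" for V
    using that by (simp add: preimage_map_def)
  have op: "openin X (?f V)" if "openin Y V" for V
    using assms(1) that val by (simp add: continuous_map_def)
  have img: "?f ` \<V> \<subseteq> carrier (opens X)" if "\<V> \<subseteq> carrier (opens Y)" for \<V>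
    using that op by auto
  have "?f (\<Squnion>\<^bsub>opens Y\<^esub> \<V>) = \<Squnion>\<^bsub>opens X\<^esub> (?f ` \<V>)" if "\<V> \<subseteq> carrier (opens Y)" for \<V>
  proof -
    have "openin Y (\<Union>\<V>)" using that by (intro openin_Union) auto
    moreover have "?f V = {x \<in> topspace X. g x \<in> V}" if "V \<in> \<V>" for V
      using that \<open>\<V> \<subseteq> carrier (opens Y)\<close> by (intro val) auto
    ultimately have "?f (\<Union>\<V>) = \<Union> (?f ` \<V>)" using val by auto
    then show ?thesis using that by (simp add: sup_opens img)
  qed
  moreover have "?f (\<Sqinter>\<^bsub>opens Y\<^esub> \<V>) = \<Sqinter>\<^bsub>opens X\<^esub> (?f ` \<V>)" if "\<V> \<subseteq> carrier (opens Y)" for \<V>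
  proof -
    have "?f V = {x \<in> topspace X. g x \<in> V}" if "V \<in> \<V>" for V
      using that \<open>\<V> \<subseteq> carrier (opens Y)\<close> by (intro val) auto
    then have "topspace X \<inter> \<Inter> (?f ` \<V>) = {x \<in> topspace X. g x \<in> \<Inter>\<V>}"
      by auto
    then have "X interior_of \<Inter> (?f ` \<V>) = ?f (Y interior_of \<Inter>\<V>)"
      by (subst interior_of_restrict) (simp only: val openin_interior_of pre)
    then show ?thesis
      using that by (simp add: inf_opens img)
  qed
  moreover have "?f (U \<rightharpoonup>\<^bsub>opens Y\<^esub> V) = ?f U \<rightharpoonup>\<^bsub>opens X\<^esub> ?f V" if "openin Y U" "openin Y V" for U V
  proof -
    have "topspace X \<inter> (- ?f U \<union> ?f V) = {x \<in> topspace X. g x \<in> - U \<union> V}"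
      using that val by auto
    then have "X interior_of (- ?f U \<union> ?f V) = ?f (Y interior_of (- U \<union> V))"
      by (subst interior_of_restrict) (simp only: val openin_interior_of pre)
    then show ?thesis
      by (simp add: himp_opens)
  qed
  moreover have "?f \<in> carrier (opens Y) \<rightarrow>\<^sub>E carrier (opens X)"
    using op by (auto simp: preimage_map_def continuous_map_def)
  ultimately show ?thesis
    unfolding cha_hom_def sup_pres_def inf_pres_def
    by (auto simp: complete_lattice_opens)
qed

text \<open>The map to the Sierpinski space that sends exactly \<open>U\<close> to \<open>0\<close> is continuous because \<open>U\<close> is
  open, and it is an open map because \<open>U\<close> is dense: the only image to avoid is \<open>{1}\<close>, the
  image of a nonempty open set that misses \<open>U\<close>.\<close>

lemma ex_cha_hom_dense_open:
  assumes "openin X U" "\<And>W. openin X W \<Longrightarrow> W \<noteq> {} \<Longrightarrow> U \<inter> W \<noteq> {}"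
  shows "\<exists>f \<in> cha_hom (opens sierpinski) (opens X). f {0} = U"
proof -
  define g :: "'a \<Rightarrow> nat" where "g x = (if x \<in> U then 0 else 1)" for x
  have sier: "openin sierpinski V \<longleftrightarrow> V \<in> {{}, {0}, {0, 1}}" for V
    using carrier_opens_sierpinski by (metis carrier_opens)
  have U: "U \<subseteq> topspace X" using assms(1) by (rule openin_subset)
  have pre: "{x \<in> topspace X. g x \<in> {0}} = U" using U by (auto simp: g_def)
  have "continuous_map X sierpinski g"
    unfolding continuous_map_def sier
  proof (intro conjI allI impI)
    show "g \<in> topspace X \<rightarrow> topspace sierpinski"
      by (auto simp: g_def topspace_sierpinski)
    fix V :: "nat set" assume "V \<in> {{}, {0}, {0, 1}}"
    then consider "V = {}" | "V = {0}" | "V = {0, 1}" by auto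
    then show "openin X {x \<in> topspace X. g x \<in> V}"
    proof cases
      case 3
      then have "{x \<in> topspace X. g x \<in> V} = topspace X" by (auto simp: g_def)
      then show ?thesis by simp
    qed (use pre assms(1) in simp_all)
  qed
  moreover have "open_map X sierpinski g"
    unfolding open_map_def openin_sierpinski
  proof (intro allI impI)
    fix W assume W: "openin X W"
    have sub: "g ` W \<subseteq> {0, 1}" by (auto simp: g_def)
    have zero: "0 \<in> g ` W" if "W \<noteq> {}"
    proof -
      from assms(2) [OF W that] obtain x where "x \<in> U" "x \<in> W" by blast
      then show ?thesis by (intro image_eqI [of _ _ x]) (simp_all add: g_def)
    qed
    show "downset_in {0, 1} (g ` W)"
      unfolding downset_in_def
    proof (intro conjI ballI impI)
      fix p t assume "p \<in> {0, 1}" "t \<in> g ` W" "p \<le> t"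
      moreover have "W \<noteq> {}" "t \<in> {0, 1}" using \<open>t \<in> g ` W\<close> sub by auto
      ultimately show "p \<in> g ` W" using zero by (cases "p = 0"; cases "t = 0") auto
    qed (rule sub)
  qed
  moreover have "preimage_map X sierpinski g {0} = U"
    using pre by (simp add: preimage_map_def sier)
  ultimately show ?thesis
    using preimage_map_cha_hom by metis
qed

section \<open>Complete subalgebras of an algebra of downsets\<close>

definition downset_topology :: "('p \<Rightarrow> 'p \<Rightarrow> bool) \<Rightarrow> 'p topology" where
  "downset_topology R = topology (\<lambda>U. \<forall>y \<in> U. \<forall>x. R x y \<longrightarrow> x \<in> U)"

lemma openin_downset_topology:
  "openin (downset_topology R) U \<longleftrightarrow> (\<forall>y \<in> U. \<forall>x. R x y \<longrightarrow> x \<in> U)"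
proof -
  have "istopology (\<lambda>U. \<forall>y \<in> U. \<forall>x. R x y \<longrightarrow> x \<in> U)"
    unfolding istopology_def by blast
  then show ?thesis
    by (simp add: downset_topology_def topology_inverse')
qed

lemma interior_of_downset_topology:
  assumes "reflp R" "transp R"
  shows "downset_topology R interior_of S = {x. \<forall>y. R y x \<longrightarrow> y \<in> S}" (is "?I = ?D")
proof
  show "?I \<subseteq> ?D"
    by (auto simp: interior_of_def openin_downset_topology)
  have "openin (downset_topology R) ?D"
    using assms(2) by (auto simp: openin_downset_topology dest: transpD)
  moreover have "?D \<subseteq> S"
    using assms(1) by (auto dest: reflpD)
  ultimately show "?D \<subseteq> ?I"
    by (rule interior_of_maximal [rotated])
qed

text \<open>The set of points in the condition on implications is \<open>U \<rightharpoonup> V\<close> computed among the downsets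
  of \<open>R\<close>, as \<open>interior_of_downset_topology\<close> shows.\<close>

locale complete_downset_algebra =
  fixes R :: "'p \<Rightarrow> 'p \<Rightarrow> bool" and G :: "'p set set"
  assumes refl: "R x x"
    and downset: "U \<in> G \<Longrightarrow> y \<in> U \<Longrightarrow> R x y \<Longrightarrow> x \<in> U"
    and Union_closed: "\<U> \<subseteq> G \<Longrightarrow> \<Union>\<U> \<in> G"
    and Inter_closed: "\<U> \<subseteq> G \<Longrightarrow> \<Inter>\<U> \<in> G"
    and himp_closed: "U \<in> G \<Longrightarrow> V \<in> G \<Longrightarrow> {x. \<forall>y. R y x \<longrightarrow> y \<in> U \<longrightarrow> y \<in> V} \<in> G"
begin

definition cl :: "'p \<Rightarrow> 'p set" where
  "cl x = \<Inter> {U \<in> G. x \<in> U}"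

lemma cl_in: "cl x \<in> G"
  unfolding cl_def by (rule Inter_closed) auto

lemma mem_cl: "x \<in> cl x"
  by (simp add: cl_def)

lemma cl_subset: "U \<in> G \<Longrightarrow> x \<in> U \<Longrightarrow> cl x \<subseteq> U"
  by (auto simp: cl_def)

lemma cl_mono: "y \<in> cl x \<Longrightarrow> cl y \<subseteq> cl x"
  by (rule cl_subset [OF cl_in])

lemma cl_eq_imp_mem_iff: "cl x = cl y \<Longrightarrow> U \<in> G \<Longrightarrow> x \<in> U \<longleftrightarrow> y \<in> U"
  using cl_subset mem_cl by blast

text \<open>The downset \<open>V\<close> of all points that lie strictly below \<open>y\<close> as seen by \<open>G\<close> is again a
  member of \<open>G\<close>.  The point \<open>y\<close> refutes \<open>cl y \<rightharpoonup> V\<close>, hence so does \<open>x\<close>, and a witness of that is a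
  point \<open>R\<close>-below \<open>x\<close> which \<open>G\<close> cannot separate from \<open>y\<close>.\<close>

lemma cl_zigzag:
  assumes y: "y \<in> cl x"
  shows "\<exists>y'. R y' x \<and> cl y' = cl y"
proof -
  define V where "V = \<Union> {cl z | z. z \<in> cl y \<and> y \<notin> cl z}"
  have V: "V \<in> G"
    unfolding V_def using cl_in by (intro Union_closed) auto
  have "y \<notin> V" by (auto simp: V_def)
  let ?I = "{x. \<forall>z. R z x \<longrightarrow> z \<in> cl y \<longrightarrow> z \<in> V}"
  have I: "?I \<in> G" by (rule himp_closed [OF cl_in V])
  have "x \<notin> ?I"
  proof
    assume "x \<in> ?I"
    then have "y \<in> ?I" using cl_subset [OF I] y by blast
    then show False using \<open>y \<notin> V\<close> mem_cl refl by blast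
  qed
  then obtain z where z: "R z x" "z \<in> cl y" "z \<notin> V" by auto
  then have "y \<in> cl z" using mem_cl by (auto simp: V_def)
  then have "cl z = cl y" using z(2) cl_mono by blast
  then show ?thesis using z(1) by blast
qed

end

lemma complete_downset_algebra_image:
  assumes "reflp R" "transp R" and C: "complete_heyting_algebra C"
    and h: "h \<in> cha_hom C (opens (downset_topology R))"
  shows "complete_downset_algebra R (h ` carrier C)"
proof -
  let ?X = "downset_topology R"
  interpret C: complete_lattice C
    by (rule complete_heyting_algebra.axioms(2) [OF C])
  note int = interior_of_downset_topology [OF assms(1,2)]
  have op: "openin ?X U" if "U \<in> h ` carrier C" for U
  proof -
    from that obtain a where a: "U = h a" "a \<in> carrier C" by blast
    have "h \<in> carrier C \<rightarrow>\<^sub>E carrier (opens ?X)" using h by (simp add: cha_hom_def)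
    then have "h a \<in> carrier (opens ?X)" using a(2) by (rule PiE_mem)
    then show ?thesis using a(1) by simp
  qed
  have sub: "h ` carrier C \<subseteq> carrier (opens ?X)" using op by auto
  show ?thesis
  proof
    show "R x x" for x using assms(1) by (rule reflpD)
    show "x \<in> U" if "U \<in> h ` carrier C" "y \<in> U" "R x y" for U x y
      using op [OF that(1)] that(2,3) by (auto simp: openin_downset_topology)
  next
    fix \<U> assume "\<U> \<subseteq> h ` carrier C"
    then obtain A where A: "A \<subseteq> carrier C" "\<U> = h ` A" by (meson subset_imageE)
    have U: "h ` A \<subseteq> carrier (opens ?X)" using A sub by blast
    have "h (\<Squnion>\<^bsub>C\<^esub> A) = \<Union>\<U>"
      using h A(1) unfolding A(2) sup_opens [OF U, symmetric] by (simp add: cha_hom_def sup_pres_def)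
    then show "\<Union>\<U> \<in> h ` carrier C"
      using C.sup_closed [OF A(1)] by (metis imageI)
    have "?X interior_of \<Inter>\<U> = \<Inter>\<U>"
      using A op by (intro interior_of_openin) (auto simp: openin_downset_topology)
    moreover have "h (\<Sqinter>\<^bsub>C\<^esub> A) = ?X interior_of \<Inter>\<U>"
      using h A(1) unfolding A(2) inf_opens [OF U, symmetric] by (simp add: cha_hom_def inf_pres_def)
    ultimately have "h (\<Sqinter>\<^bsub>C\<^esub> A) = \<Inter>\<U>" by simp
    then show "\<Inter>\<U> \<in> h ` carrier C"
      using C.inf_closed [OF A(1)] by (metis imageI)
  next
    fix U V assume "U \<in> h ` carrier C" "V \<in> h ` carrier C"
    then obtain a b where ab: "a \<in> carrier C" "b \<in> carrier C" "U = h a" "V = h b"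
      by (elim imageE)
    have "h (a \<rightharpoonup>\<^bsub>C\<^esub> b) = ?X interior_of (- U \<union> V)"
      unfolding ab(3,4) himp_opens [symmetric] using h ab(1,2) by (simp add: cha_hom_def)
    also have "\<dots> = {x. \<forall>y. R y x \<longrightarrow> y \<in> U \<longrightarrow> y \<in> V}"
      unfolding int by blast
    finally have "h (a \<rightharpoonup>\<^bsub>C\<^esub> b) = {x. \<forall>y. R y x \<longrightarrow> y \<in> U \<longrightarrow> y \<in> V}" .
    then show "{x. \<forall>y. R y x \<longrightarrow> y \<in> U \<longrightarrow> y \<in> V} \<in> h ` carrier C"
      using heyting_algebra.himp_closed [OF complete_heyting_algebra.axioms(1) [OF C] ab(1,2)] by (metis imageI)
  qed
qed

section \<open>Arbitrarily large posets separated by two dense downsets\<close>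

text \<open>\<open>Spur\<close> is a point that no rung sees and every node does, which keeps the two families apart.
  An index \<open>a\<close> without predecessors has no nodes below it, so there \<open>Node a m\<close> is distinguished by
  the height \<open>m\<close> up to which it sees the ladder.  These nodes of least index form an infinite
  antichain, from which the second coordinates of all later nodes are told apart.  A later node
  sees the nodes of least index at infinitely many heights and hence, by transitivity, the
  whole ladder.\<close>

datatype 'i point = Root | Spur | Rung nat | Node 'i nat

primrec strictly_below :: "'i rel \<Rightarrow> 'i point \<Rightarrow> 'i point set" where
  "strictly_below s Root = {}"
| "strictly_below s Spur = {Root}"
| "strictly_below s (Rung n) = insert Root (Rung ` {k. k + 2 \<le> n})"
| "strictly_below s (Node a m) =
     {Root, Spur} \<union> Rung ` {k. k \<le> m \<or> (\<exists>b. (b, a) \<in> s)} \<union> {Node b n | b n. (b, a) \<in> s \<and> m \<le> n}"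

definition point_le :: "'i rel \<Rightarrow> 'i point \<Rightarrow> 'i point \<Rightarrow> bool" where
  "point_le s x y \<longleftrightarrow> x = y \<or> x \<in> strictly_below s y"

lemma reflp_point_le: "reflp (point_le s)"
  by (auto simp: reflp_def point_le_def)

lemma transp_point_le:
  assumes "trans s"
  shows "transp (point_le s)"
proof (rule transpI)
  fix x y z assume "point_le s x y" "point_le s y z"
  then show "point_le s x z"
    using assms by (cases z; cases y) (auto simp: point_le_def dest: transD)
qed

lemma Root_point_le: "point_le s Root x"
  by (cases x) (auto simp: point_le_def)

text \<open>The assumption \<open>zigzag\<close> says that having equal values under \<open>c\<close> is a bisimulation, and the two
  others that it respects the generating downsets.  Rungs are identified by induction on their
  height, using that for \<open>n \<ge> 1\<close> all rungs above \<open>n\<close> see \<open>Rung (n - 1)\<close> while \<open>Rung n\<close> does not.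
  Nodes are identified by induction on the index.\<close>

lemma point_rigid:
  fixes c :: "'i point \<Rightarrow> 'd"
  assumes wf: "wf s" and total: "total s"
    and zigzag: "\<And>x x' y. c x = c x' \<Longrightarrow> point_le s y x \<Longrightarrow> \<exists>y'. point_le s y' x' \<and> c y' = c y"
    and left: "\<And>x x'. c x = c x' \<Longrightarrow> x \<in> {Root, Rung 0} \<longleftrightarrow> x' \<in> {Root, Rung 0}"
    and right: "\<And>x x'. c x = c x' \<Longrightarrow> x \<in> {Root, Spur} \<longleftrightarrow> x' \<in> {Root, Spur}"
  shows "inj c"
proof -
  have Root: "x = Root" if "c x = c Root" for x
    using left [OF that] right [OF that] by auto
  have Spur: "x = Spur" if "c x = c Spur" for x
    using left [OF that] right [OF that] by auto
  have Rung0: "x = Rung 0" if "c x = c (Rung 0)" for x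
    using left [OF that] right [OF that] by auto
  \<comment> \<open>A rung equivalent to a node would have to see a copy of \<open>Spur\<close>.\<close>
  have not_Node: "c (Rung n) \<noteq> c (Node a m)" for n a m
  proof
    assume "c (Rung n) = c (Node a m)"
    then obtain y where "point_le s y (Rung n)" "c y = c Spur"
      using zigzag [of "Node a m" "Rung n" Spur] by (auto simp: point_le_def)
    then show False using Spur by (auto simp: point_le_def)
  qed
  have Rung: "x = Rung n" if "c x = c (Rung n)" for x n
    using that
  proof (induction n arbitrary: x rule: less_induct)
    case (less n)
    show ?case
    proof (cases "n = 0")
      case True
      then show ?thesis using less.prems Rung0 by simp
    next
      case False
      have "x \<noteq> Root" "x \<noteq> Spur"
        using less.prems Root [of "Rung n"] Spur [of "Rung n"] by auto
      moreover have "x \<noteq> Node a k" for a k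
        using less.prems not_Node [of n a k] by auto
      ultimately obtain m where m: "x = Rung m"
        by (cases x) auto
      have "\<not> m < n" using less.IH [of m "Rung n"] less.prems m by auto
      moreover have False if "n < m"
      proof -
        have "point_le s (Rung (n - 1)) x"
          using that False by (auto simp: m point_le_def)
        then obtain y where y: "point_le s y (Rung n)" "c y = c (Rung (n - 1))"
          using zigzag less.prems by blast
        then have "y = Rung (n - 1)" using less.IH False by simp
        then show False using y(1) False by (auto simp: point_le_def)
      qed
      ultimately show ?thesis using m by force
    qed
  qed
  have Node: "x = Node a m" if "c x = c (Node a m)" for x a m
    using wf that
  proof (induction a arbitrary: x m rule: wf_induct_rule)
    case (less a)
    have irrefl: "(b, b) \<notin> s" for b using wf by auto
    \<comment> \<open>The node with the smaller coordinate sees the earlier \<open>Node b m\<close>, the other does not.  At the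
      least index the ladder plays this role in the opposite direction.\<close>
    have same_index: False if mk: "m < k" and c: "c (Node a m) = c (Node a k)" for m k
    proof (cases "\<exists>b. (b, a) \<in> s")
      case True
      then obtain b where b: "(b, a) \<in> s" by blast
      then have "point_le s (Node b m) (Node a m)" by (auto simp: point_le_def)
      then obtain y where y: "point_le s y (Node a k)" "c y = c (Node b m)"
        using zigzag c by blast
      then have "y = Node b m" using less.IH b by blast
      then show False using y(1) mk b irrefl by (auto simp: point_le_def)
    next
      case False
      have "point_le s (Rung k) (Node a k)" by (auto simp: point_le_def)
      then obtain y where y: "point_le s y (Node a m)" "c y = c (Rung k)"
        using zigzag c [symmetric] by blast
      then have "y = Rung k" using Rung by blast
      then show False using y(1) mk False by (auto simp: point_le_def)
    qed
    have "x \<noteq> Root" "x \<noteq> Spur" "x \<noteq> Rung k" for k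
      using less.prems Root [of "Node a m"] Spur [of "Node a m"] Rung [of "Node a m" k] by auto
    then obtain a' m' where x: "x = Node a' m'"
      by (cases x) auto
    consider "(a', a) \<in> s" | "a' = a" | "(a, a') \<in> s"
      using total by (auto simp: total_on_def)
    then show ?case
    proof cases
      case 1
      then show ?thesis using less.IH [of a' "Node a m" m'] less.prems x by auto
    next
      case 2
      then show ?thesis using same_index less.prems x by (metis nat_neq_iff)
    next
      case 3
      \<comment> \<open>\<open>Node a' m'\<close> sees the nodes of index \<open>a\<close> at infinitely many coordinates, so at some
        \<open>n \<noteq> m\<close>; nothing below \<open>Node a m\<close> is equivalent to \<open>Node a n\<close>.\<close>
      define n where "n = (if m = m' then Suc m' else m')"
      have n: "m' \<le> n" "n \<noteq> m" by (auto simp: n_def)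
      have "point_le s (Node a n) x" using 3 n by (auto simp: x point_le_def)
      then obtain y where y: "point_le s y (Node a m)" "c y = c (Node a n)"
        using zigzag less.prems by blast
      have False
      proof (cases "y = Node a m")
        case True
        then show False using same_index y(2) n(2) by (metis nat_neq_iff)
      next
        case False
        moreover have "y \<noteq> Root" "y \<noteq> Spur" "y \<noteq> Rung k" for k
          using y(2) Root [of "Node a n"] Spur [of "Node a n"] Rung [of "Node a n" k] by auto
        ultimately obtain b k where b: "y = Node b k" "(b, a) \<in> s"
          using y(1) by (auto simp: point_le_def)
        then have "Node a n = Node b k" using less.IH [of b "Node a n" k] y(2) by simp
        then show False using b irrefl by simp
      qed
      then show ?thesis ..
    qed
  qed
  show ?thesis
  proof (rule injI)
    fix x y assume "c x = c y"
    then show "x = y"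
      by (cases y) (use Root Spur Rung Node in auto)
  qed
qed

text \<open>The order on points is pulled back along a surjection \<open>\<pi>\<close>, which lets an algebra of downsets of
  points live on any sufficiently large type.  The resulting preorder has the same downsets up
  to isomorphism, as points with the same image under \<open>\<pi>\<close> lie in the same downsets.\<close>

lemma index_type_injects_into_algebra_hitting_generators:
  fixes C :: "'c heyting" and \<pi> :: "'p \<Rightarrow> 'i point"
  assumes wf: "wf s" and trans: "trans s" and total: "total s" and "surj \<pi>"
    and C: "complete_heyting_algebra C"
    and h: "h \<in> cha_hom C (opens (downset_topology (\<lambda>u v. point_le s (\<pi> u) (\<pi> v))))"
    and left: "\<pi> -` {Root, Rung 0} \<in> h ` carrier C"
    and right: "\<pi> -` {Root, Spur} \<in> h ` carrier C"
  shows "\<exists>k :: 'i \<Rightarrow> 'c. inj k"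
proof -
  define R where "R u v = point_le s (\<pi> u) (\<pi> v)" for u v
  define rep where "rep = inv \<pi>"
  have rep: "\<pi> (rep x) = x" for x
    using \<open>surj \<pi>\<close> by (simp add: rep_def surj_f_inv_f)
  have R: "reflp R" "transp R"
    using reflp_point_le [of s] transp_point_le [OF trans]
    unfolding R_def reflp_def transp_def by blast+
  define G where "G = h ` carrier C"
  interpret complete_downset_algebra R G
    unfolding G_def using complete_downset_algebra_image [OF R C] h by (simp add: R_def [abs_def])
  define c where "c x = cl (rep x)" for x
  have cl_eq: "cl u = c (\<pi> u)" for u
  proof -
    have "R u (rep (\<pi> u))" "R (rep (\<pi> u)) u"
      by (simp_all add: R_def rep point_le_def)
    then have "u \<in> cl (rep (\<pi> u))" "rep (\<pi> u) \<in> cl u"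
      using downset [OF cl_in mem_cl] by blast+
    then show ?thesis
      unfolding c_def using cl_mono by blast
  qed
  have "inj c"
  proof (rule point_rigid [OF wf total])
    fix x x' y assume c: "c x = c x'" and "point_le s y x"
    then have "R (rep y) (rep x)" by (simp add: R_def rep)
    then have "rep y \<in> cl (rep x)" by (rule downset [OF cl_in mem_cl])
    then have "rep y \<in> cl (rep x')" using c by (simp add: c_def)
    then obtain v where v: "R v (rep x')" "cl v = c y"
      using cl_zigzag unfolding c_def by blast
    then have "point_le s (\<pi> v) x'" "c (\<pi> v) = c y"
      using cl_eq by (simp_all add: R_def rep)
    then show "\<exists>y'. point_le s y' x' \<and> c y' = c y" by blast
  next
    fix x x' assume "c x = c x'"
    then have cl: "cl (rep x) = cl (rep x')" by (simp add: c_def)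
    show "x \<in> {Root, Rung 0} \<longleftrightarrow> x' \<in> {Root, Rung 0}"
      using cl_eq_imp_mem_iff [OF cl left [folded G_def]] by (simp add: rep)
    show "x \<in> {Root, Spur} \<longleftrightarrow> x' \<in> {Root, Spur}"
      using cl_eq_imp_mem_iff [OF cl right [folded G_def]] by (simp add: rep)
  qed
  have "\<exists>a. h a = c (Node i 0)" for i
    using cl_in unfolding c_def G_def by (metis imageE)
  then obtain k where k: "h (k i) = c (Node i 0)" for i by metis
  have "inj k"
  proof (rule injI)
    fix i j assume "k i = k j"
    then have "c (Node i 0) = c (Node j 0)" using k by metis
    then show "i = j" using injD [OF \<open>inj c\<close>] by blast
  qed
  then show ?thesis by blast
qed

lemma ex_strict_well_order: "\<exists>s :: 'a rel. wf s \<and> trans s \<and> total s"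
proof -
  obtain r :: "'a rel" where "Well_order r \<and> Field r = UNIV"
    using well_ordering ..
  then have "wf (r - Id)" "trans (r - Id)" "total (r - Id)"
    by (auto simp: well_order_on_def linear_order_on_def partial_order_on_def preorder_on_def
        intro: trans_diff_Id)
  then show ?thesis by blast
qed

section \<open>Nonexistence of the coproduct\<close>

text \<open>The elements \<open>Inr 0\<close> and \<open>Inr 1\<close> mark the constructor, so numerical arguments are shifted by \<open>2\<close>.\<close>

primrec encode :: "'c set point \<Rightarrow> ('c + nat) set" where
  "encode Root = {}"
| "encode Spur = {Inr 0}"
| "encode (Rung n) = {Inr (n + 2)}"
| "encode (Node S n) = Inl ` S \<union> {Inr 1, Inr (n + 2)}"

lemma inj_encode: "inj encode"
proof (rule injI)
  fix x y :: "'a set point" assume *: "encode x = encode y"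
  define p :: "('a + nat) set \<Rightarrow> _"
    where "p U = (Inr 0 \<in> U, Inr 1 \<in> U, Inl -` U, {k. Inr (k + 2) \<in> U})" for U
  have "p (encode x) = p (encode y)" using * by simp
  then show "x = y"
    by (cases x; cases y) (auto simp: p_def)
qed

theorem theorem4p2:
  shows "\<nexists>(C :: 'c heyting) \<iota>\<^sub>1 \<iota>\<^sub>2.
    is_cha_coproduct TYPE(('c + nat) set set) (opens sierpinski) (opens sierpinski) C \<iota>\<^sub>1 \<iota>\<^sub>2"
proof (intro notI, elim exE)
  fix C :: "'c heyting" and \<iota>\<^sub>1 \<iota>\<^sub>2
  assume coproduct:
    "is_cha_coproduct TYPE(('c + nat) set set) (opens sierpinski) (opens sierpinski) C \<iota>\<^sub>1 \<iota>\<^sub>2"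
  obtain s :: "'c set rel" where s: "wf s" "trans s" "total s"
    using ex_strict_well_order by blast
  define \<pi> :: "('c + nat) set \<Rightarrow> 'c set point" where "\<pi> = inv encode"
  have \<pi>: "surj \<pi>"
    unfolding \<pi>_def by (rule inj_imp_surj_inv [OF inj_encode])
  define X where "X = downset_topology (\<lambda>u v. point_le s (\<pi> u) (\<pi> v))"
  have hom: "\<exists>f \<in> cha_hom (opens sierpinski) (opens X). f {0} = \<pi> -` {Root, p}"
    if p: "p \<in> {Spur, Rung 0}" for p
  proof (rule ex_cha_hom_dense_open)
    show "openin X (\<pi> -` {Root, p})"
      using p by (auto simp: X_def openin_downset_topology point_le_def)
    fix W assume W: "openin X W" "W \<noteq> {}"
    obtain w where w: "w \<in> W" using W(2) by blast
    obtain u where u: "\<pi> u = Root" using \<pi> by (metis surjD)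
    have "u \<in> W"
      using W(1) w u Root_point_le unfolding X_def openin_downset_topology by metis
    then show "\<pi> -` {Root, p} \<inter> W \<noteq> {}" using u by auto
  qed
  obtain f where f: "f \<in> cha_hom (opens sierpinski) (opens X)" "f {0} = \<pi> -` {Root, Rung 0}"
    using hom [of "Rung 0"] by blast
  obtain g where g: "g \<in> cha_hom (opens sierpinski) (opens X)" "g {0} = \<pi> -` {Root, Spur}"
    using hom [of Spur] by blast
  have C: "complete_heyting_algebra C"
    and \<iota>: "\<iota>\<^sub>1 \<in> cha_hom (opens sierpinski) C" "\<iota>\<^sub>2 \<in> cha_hom (opens sierpinski) C"
    using coproduct by (simp_all add: is_cha_coproduct_def)
  have "\<exists>!h. h \<in> cha_hom C (opens X) \<and> compose (carrier (opens sierpinski)) h \<iota>\<^sub>1 = f \<and>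
      compose (carrier (opens sierpinski)) h \<iota>\<^sub>2 = g"
    using coproduct f(1) g(1) complete_heyting_algebra_opens [of X]
    by (simp add: is_cha_coproduct_def)
  then obtain h where h: "h \<in> cha_hom C (opens X)"
    and hf: "compose (carrier (opens sierpinski)) h \<iota>\<^sub>1 = f"
    and hg: "compose (carrier (opens sierpinski)) h \<iota>\<^sub>2 = g"
    by (elim ex1E conjE)
  have 0: "{0} \<in> carrier (opens sierpinski)"
    by (simp only: carrier_opens_sierpinski) simp
  have closed: "\<iota> {0} \<in> carrier C" if "\<iota> \<in> cha_hom (opens sierpinski) C" for \<iota>
  proof -
    have "\<iota> \<in> carrier (opens sierpinski) \<rightarrow>\<^sub>E carrier C" using that by (simp add: cha_hom_def)
    then show ?thesis using 0 by (rule PiE_mem)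
  qed
  have "f {0} = h (\<iota>\<^sub>1 {0})" "g {0} = h (\<iota>\<^sub>2 {0})"
    using compose_eq [OF 0] hf hg by metis+
  then have "\<pi> -` {Root, Rung 0} \<in> h ` carrier C" "\<pi> -` {Root, Spur} \<in> h ` carrier C"
    using f(2) g(2) closed [OF \<iota>(1)] closed [OF \<iota>(2)] by (metis imageI)+
  then obtain k :: "'c set \<Rightarrow> 'c" where "inj k"
    using index_type_injects_into_algebra_hitting_generators [OF s \<pi> C h [unfolded X_def]] by blast
  then have "surj (inv k)" by (rule inj_imp_surj_inv)
  then have "inv k ` UNIV = Pow UNIV" by simp
  then show False using Cantors_theorem by blast
qed

end
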